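(* Let $\lambda>0$ and $\beta\in(0,1]$. The generalized Appell polynomial system $\{C_n^{\lambda,\beta}: n\in\mathbb{N}_0\}$ and the generalized dual Appell system $\{Q_m^{\pi_{\lambda,\beta}}: m\in\mathbb{N}_0\}$ are biorthogonal with respect to $L^2(\pi_{\lambda,\beta})$, and $$\langle\!\langle C_n^{\lambda,\beta},Q_m^{\pi_{\lambda,\beta}}\rangle\!\rangle_{\pi_{\lambda,\beta}}=n!\,\delta_{n,m},\qquad n,m\in\mathbb{N}_0,$$ where $\delta_{n,m}$ is the Kronecker delta.
   Context: $\mathbb{N}_0=\{0,1,2,\dots\}$. The Mittag-Leffler function is $E_\beta(z)=\sum_{n=0}^\infty \frac{z^n}{\Gamma(\beta n+1)}$, $z\in\mathbb{C}$. The fractional Poisson measure $\pi_{\lambda,\beta}$ is the probability measure on $\mathbb{R}$ concentrated on $\mathbb{N}_0$ with $\pi_{\lambda,\beta}(\{k\})=\frac{\lambda^k}{k!}E_\beta^{(k)}(-\lambda)$; its Laplace transform is $\int_{\mathbb{R}}e^{zx}\,\mathrm{d}\pi_{\lambda,\beta}(x)=E_\beta(\lambda(e^z-1))$, and all its moments are finite. The generalized Appell polynomials $C_n^{\lambda,\beta}$ (of degree $n$) are defined by $\frac{e^{x\log(1+z)}}{E_\beta(\lambda z)}=\sum_{n=0}^\infty\frac{z^n}{n!}C_n^{\lambda,\beta}(x)$ for $z$ in a neighborhood of $0\in\mathbb{C}$. $\mathcal{P}(\mathbb{R})$ is the space of polynomials on $\mathbb{R}$ with complex coefficients, with the following convergence: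 a sequence converges iff the degrees are bounded and the coefficients converge term by term. $\mathcal{P}'_{\pi_{\lambda,\beta}}(\mathbb{R})$ is the dual of $\mathcal{P}(\mathbb{R})$ (continuous linear functionals), with dual pairing $\langle\!\langle\varphi,\Phi\rangle\!\rangle_{\pi_{\lambda,\beta}}=\Phi(\varphi)$, where $\Phi\in L^2(\pi_{\lambda,\beta})$ (complex-valued) is regarded as the functional $\langle\!\langle\varphi,\Phi\rangle\!\rangle_{\pi_{\lambda,\beta}}=\int_{\mathbb{R}}\varphi(x)\Phi(x)\,\mathrm{d}\pi_{\lambda,\beta}(x)$. Let $\nabla=\frac{\mathrm{d}}{\mathrm{d}x}$, $g(z)=e^z-1$, and let $g(\nabla)^k$ act on $\mathcal{P}(\mathbb{R})$ by $g(\nabla)^k\varphi=k!\sum_{n=k}^\infty\frac{S(n,k)}{n!}\frac{\mathrm{d}^n\varphi}{\mathrm{d}x^n}$, where $S(n,k)$ are the Stirling numbers of the second kind; equivalently $g(\nabla)^k=\Delta^k$ with $(\Delta\varphi)(x)=\varphi(x+1)-\varphi(x)$. Its adjoint on $\mathcal{P}'_{\pi_{\lambda,\beta}}(\mathbb{R})$ is defined by $\langle\!\langle\varphi,(g(\nabla)^k)^*\Phi\rangle\!\rangle_{\pi_{\lambda,\beta}}=\langle\!\langle g(\nabla)^k\varphi,\Phi\rangle\!\rangle_{\pi_{\lambda,\beta}}$. The generalized dual Appell system is $Q_k^{\pi_{\lambda,\beta}}:=(g(\nabla)^k)^*\mathbf{1}$, $k\in\mathbb{N}_0$, where $\mathbf{1}$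 is the constant function $1$. *)

theory Defs
  imports "HOL-Probability.Probability" "HOL-Combinatorics.Stirling"
    "HOL-Computational_Algebra.Polynomial"
begin

definition mittag_leffler :: "real \<Rightarrow> complex \<Rightarrow> complex" where
  "mittag_leffler \<beta> z = (\<Sum>n. z ^ n / of_real (Gamma (\<beta> * real n + 1)))"

text \<open>
  For \<open>0 < \<beta> \<le> 1\<close> and \<open>l > 0\<close> the derivatives of the Mittag-Leffler function at \<open>- l\<close> are real
  and nonnegative (the function \<open>t \<mapsto> E\<^sub>\<beta>(-t)\<close> is completely monotone on the positive half-line), so
  neither \<^const>\<open>Re\<close> nor \<^const>\<open>ennreal\<close> changes the weights.
\<close>

definition fractional_poisson :: "real \<Rightarrow> real \<Rightarrow> real measure" where
  "fractional_poisson l \<beta> =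
     distr (density (count_space UNIV)
       (\<lambda>k::nat. ennreal (l ^ k / fact k *
          Re ((deriv ^^ k) (mittag_leffler \<beta>) (- of_real l))))) borel real"

text \<open>
  The polynomials with complex coefficients whose exponential generating function is
  \<open>exp (x log (1 + z)) / E\<^sub>\<beta>(l z)\<close>. The neighbourhood of \<open>0\<close> does not depend on \<open>x\<close>; there
  \<^const>\<open>Ln\<close> is the branch of the logarithm vanishing at \<open>1\<close>.
\<close>

definition gen_appell :: "real \<Rightarrow> real \<Rightarrow> nat \<Rightarrow> complex poly" where
  "gen_appell l \<beta> = (THE C. \<forall>\<^sub>F z in nhds (0::complex). \<forall>x::real.
     (\<lambda>n. z ^ n / fact n * poly (C n) (of_real x)) sums
       (exp (of_real x * Ln (1 + z)) / mittag_leffler \<beta> (of_real l * z)))"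

definition poly_converges :: "(nat \<Rightarrow> complex poly) \<Rightarrow> complex poly \<Rightarrow> bool" where
  "poly_converges p q \<longleftrightarrow>
     (\<exists>d. \<forall>n. degree (p n) \<le> d) \<and> (\<forall>i. (\<lambda>n. coeff (p n) i) \<longlonglongrightarrow> coeff q i)"

definition poly_dual :: "(complex poly \<Rightarrow> complex) set" where
  "poly_dual = {\<Phi>. Vector_Spaces.linear smult (*) \<Phi> \<and>
     (\<forall>p q. poly_converges p q \<longrightarrow> (\<lambda>n. \<Phi> (p n)) \<longlonglongrightarrow> \<Phi> q)}"

definition dual_pairing :: "complex poly \<Rightarrow> (complex poly \<Rightarrow> complex) \<Rightarrow> complex" where
  "dual_pairing \<phi> \<Phi> = \<Phi> \<phi>"

text \<open>The (bilinear, without conjugation) embedding of \<open>L\<^sup>2(M)\<close> into the dual space.\<close>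

definition L2_functional :: "real measure \<Rightarrow> (real \<Rightarrow> complex) \<Rightarrow> complex poly \<Rightarrow> complex" where
  "L2_functional M f = (\<lambda>\<phi>. \<integral>x. poly \<phi> (of_real x) * f x \<partial>M)"

definition dual_adjoint ::
    "(complex poly \<Rightarrow> complex poly) \<Rightarrow> (complex poly \<Rightarrow> complex) \<Rightarrow> (complex poly \<Rightarrow> complex)" where
  "dual_adjoint T \<Phi> =
     (THE \<Psi>. \<Psi> \<in> poly_dual \<and> (\<forall>\<phi>. dual_pairing \<phi> \<Psi> = dual_pairing (T \<phi>) \<Phi>))"

text \<open>
  The operator \<open>g(\<nabla>)\<^sup>k\<close> for \<open>g(z) = exp z - 1\<close>. The series over \<open>n \<ge> k\<close> stops at the degree of
  the polynomial, since all higher derivatives vanish.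
\<close>

definition g_nabla_pow :: "nat \<Rightarrow> complex poly \<Rightarrow> complex poly" where
  "g_nabla_pow k \<phi> = smult (fact k)
     (\<Sum>n=k..degree \<phi>. smult (of_nat (Stirling n k) / fact n) ((pderiv ^^ n) \<phi>))"

definition dual_appell :: "real \<Rightarrow> real \<Rightarrow> nat \<Rightarrow> complex poly \<Rightarrow> complex" where
  "dual_appell l \<beta> k =
     dual_adjoint (g_nabla_pow k) (L2_functional (fractional_poisson l \<beta>) (\<lambda>x. 1))"

end

theory Submission
  imports Defs "HOL-Complex_Analysis.Complex_Analysis" "HOL-Real_Asymp.Real_Asymp"
begin

text \<open>
  Biorthogonality is formal once the weights of the fractional Poisson measure are known to be
  nonnegative: Taylor expansion of \<open>E\<^sub>\<beta>\<close> and its derivatives around \<open>-l\<close> shows that the integral of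
  the binomial polynomial \<open>x gchoose r\<close> is \<open>l ^ r / Gamma (\<beta> r + 1)\<close>, the \<open>r\<close>-th coefficient of
  \<open>E\<^sub>\<beta>(l z)\<close>. The Appell polynomial \<open>C\<^sub>n / n!\<close> is the sum of \<open>a\<^sub>j (x gchoose (n - j))\<close>, where the \<open>a\<^sub>j\<close>
  are the coefficients of \<open>1 / E\<^sub>\<beta>(l z)\<close>, and \<open>g(\<nabla>) ^ m\<close> lowers the index of a binomial polynomial
  by \<open>m\<close>. So the pairing is \<open>n!\<close> times the \<open>(n - m)\<close>-th coefficient of \<open>(1 / E\<^sub>\<beta>(l z)) E\<^sub>\<beta>(l z) = 1\<close>.

  That the derivatives of \<open>E\<^sub>\<beta>\<close> are nonnegative at \<open>-l\<close> is proved by discretisation. For \<open>\<beta> \<le> 1\<close> the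
  function \<open>1 - (1 - z) powr \<beta>\<close> has nonnegative Taylor coefficients at \<open>0\<close>, hence so does
  \<open>(1 - z) powr (\<beta> - 1) / (\<epsilon> + (1 - z) powr \<beta>) ^ (k + 1)\<close>. Its \<open>n\<close>-th coefficient, expanded in
  powers of \<open>\<epsilon>\<close> at \<open>\<epsilon> = l n powr (-\<beta>)\<close> and multiplied by \<open>n powr (-\<beta> k)\<close>, tends to the \<open>k\<close>-th
  derivative at \<open>-l\<close> divided by \<open>k!\<close>.
\<close>

section \<open>Nonnegativity of the derivatives of the Mittag-Leffler function\<close>

text \<open>The Taylor coefficients of \<open>(1 - z) powr (- a)\<close>.\<close>

definition rbinom :: "real \<Rightarrow> nat \<Rightarrow> real" where
  "rbinom a n = pochhammer a n / fact n"

lemma rbinom_0 [simp]: "rbinom a 0 = 1"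
  by (simp add: rbinom_def)

lemma rbinom_Suc: "rbinom a (Suc n) = rbinom a n * ((a + real n) / real (Suc n))"
  by (simp add: rbinom_def pochhammer_Suc field_simps)

lemma rbinom_nonneg: "a \<ge> 0 \<Longrightarrow> rbinom a n \<ge> 0"
  by (auto simp: rbinom_def pochhammer_prod intro!: divide_nonneg_nonneg prod_nonneg)

text \<open>Chu-Vandermonde: the Cauchy product of the series of \<open>(1 - z) powr (- a)\<close>
  and \<open>(1 - z) powr (- b)\<close>. It allows multiplication by a power of \<open>1 - z\<close>
  to be done on coefficients.\<close>

lemma rbinom_convolution: "(\<Sum>k\<le>n. rbinom a k * rbinom b (n - k)) = rbinom (a + b) n"
proof -
  have "rbinom a k * rbinom b (n - k) =
          real (n choose k) * pochhammer a k * pochhammer b (n - k) / fact n" if "k \<le> n" for k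
    using that by (simp add: rbinom_def binomial_fact field_simps)
  then show ?thesis
    by (simp add: rbinom_def pochhammer_binomial_sum sum_divide_distrib)
qed

text \<open>Each factor \<open>1 + a / (i + 1)\<close> of the product is at most
  \<open>1 + a\<close>. For fixed \<open>n\<close> the growth in \<open>a\<close> is thus
  polynomial, which a geometric factor beats.\<close>

lemma rbinom_le_power:
  assumes "a \<ge> 0"
  shows "rbinom (a + 1) n \<le> (1 + a) ^ n"
proof (induction n)
  case (Suc n)
  have "(a + 1 + real n) / real (Suc n) \<le> 1 + a"
    using assms by (simp add: field_simps)
  then have "rbinom (a + 1) n * ((a + 1 + real n) / real (Suc n)) \<le> (1 + a) ^ n * (1 + a)"
    using Suc assms by (intro mult_mono) auto
  then show ?case
    unfolding rbinom_Suc by (simp only: power_Suc2)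
qed auto

text \<open>Consecutive terms have ratio \<open>(1 + a / (n + 1)) * (n / (n + 1)) powr a\<close>, at
  most 1 because \<open>ln (1 + a / (n + 1)) \<le> a / (n + 1) \<le> a * ln ((n + 1) / n)\<close>.
  Monotonicity supplies both a majorant uniform in \<open>n\<close> and an upper bound for the
  limit.\<close>

lemma rbinom_scaled_antimono:
  assumes "a \<ge> 0" "0 < m" "m \<le> n"
  shows "rbinom (a + 1) n * real n powr - a \<le> rbinom (a + 1) m * real m powr - a"
  using assms(3)
proof (induction n rule: dec_induct)
  case (step n)
  have n: "n > 0" using step assms by simp
  have "ln (1 + a / real (Suc n)) \<le> a / real (Suc n)"
    using assms by (intro ln_add_one_self_le_self) auto
  also have "\<dots> \<le> a * ln (real (Suc n) / real n)"
  proof -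
    have "ln (real n / real (Suc n)) \<le> real n / real (Suc n) - 1"
      using n by (intro ln_le_minus_one) auto
    also have "\<dots> = - (1 / real (Suc n))"
      by (simp add: field_simps)
    finally have "1 / real (Suc n) \<le> ln (real (Suc n) / real n)"
      using n by (simp add: ln_div)
    from mult_left_mono[OF this assms(1)] show ?thesis by simp
  qed
  finally have "exp (ln (1 + a / real (Suc n))) \<le> exp (a * ln (real (Suc n) / real n))"
    by simp
  then have "1 + a / real (Suc n) \<le> (real (Suc n) / real n) powr a"
    using n assms by (simp add: powr_def add_pos_nonneg)
  then have *: "(1 + a / real (Suc n)) * real (Suc n) powr - a \<le> real n powr - a"
    using n by (simp add: powr_divide powr_minus field_simps del: of_nat_Suc)
  have "rbinom (a + 1) (Suc n) * real (Suc n) powr - a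
      = rbinom (a + 1) n * ((1 + a / real (Suc n)) * real (Suc n) powr - a)"
    by (simp add: rbinom_Suc add_divide_distrib add_ac) (simp add: field_simps)
  also have "\<dots> \<le> rbinom (a + 1) n * real n powr - a"
    using * assms by (intro mult_left_mono rbinom_nonneg) auto
  finally show ?case using step.IH by linarith
qed auto

text \<open>Gauss's limit for the reciprocal Gamma function; the factor
  \<open>n / (a + 1 + n)\<close> removes the last Pochhammer factor and one surplus power of
  \<open>n\<close>.\<close>

lemma rbinom_scaled_LIMSEQ:
  assumes "a \<ge> 0"
  shows "(\<lambda>n. rbinom (a + 1) n * real n powr - a) \<longlonglongrightarrow> 1 / Gamma (a + 1)"
proof -
  have "(\<lambda>n. rGamma_series (a + 1) n * (real n / (a + 1 + real n))) \<longlonglongrightarrow> rGamma (a + 1) * 1"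
    by (intro tendsto_intros) real_asymp
  moreover have "eventually (\<lambda>n. rGamma_series (a + 1) n * (real n / (a + 1 + real n)) =
      rbinom (a + 1) n * real n powr - a) sequentially"
    using eventually_gt_at_top[of 0]
  proof eventually_elim
    case (elim n)
    have nz: "a + 1 + real n \<noteq> 0" using assms by linarith
    have "exp ((a + 1) * ln (real n)) = real n * real n powr a"
      using elim by (simp add: powr_def ring_distribs exp_add)
    then have "rGamma_series (a + 1) n =
        pochhammer (a + 1) n * (a + 1 + real n) / (fact n * (real n * real n powr a))"
      by (simp add: rGamma_series_def pochhammer_Suc)
    then show ?case
      using elim nz by (simp add: rbinom_def powr_minus_divide)
  qed
  ultimately have "(\<lambda>n. rbinom (a + 1) n * real n powr - a) \<longlonglongrightarrow> rGamma (a + 1) * 1"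
    by (rule Lim_transform_eventually)
  then show ?thesis by (simp add: Gamma_def field_simps)
qed

lemma summable_power_mult_geometric:
  fixes q :: real
  assumes "0 \<le> q" "q < 1"
  shows "summable (\<lambda>j. real (c + j) ^ m * q ^ j)"
proof (cases "q = 0")
  case True
  have "summable (\<lambda>j. real (c + j) ^ m * 0 ^ j)"
    by (rule summable_0_powser)
  then show ?thesis using True by simp
next
  case False
  then have q: "q > 0" using assms by simp
  define r where "r = (q + 1) / 2"
  have r: "q < r" "r < 1" using assms by (auto simp: r_def)
  have "(\<lambda>j. real (c + Suc j) / real (c + j)) \<longlonglongrightarrow> 1"
    unfolding of_nat_add of_nat_Suc by real_asymp
  then have "(\<lambda>j. (real (c + Suc j) / real (c + j)) ^ m) \<longlonglongrightarrow> 1 ^ m"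
    by (rule tendsto_power)
  then have "(\<lambda>j. (real (c + Suc j) / real (c + j)) ^ m * q) \<longlonglongrightarrow> 1 ^ m * q"
    by (rule tendsto_mult_right)
  then have "eventually (\<lambda>j. (real (c + Suc j) / real (c + j)) ^ m * q < r) sequentially"
    using r by (intro order_tendstoD(2)) auto
  \<comment> \<open>Requiring \<open>j > 0\<close> keeps the denominator \<open>c + j\<close>
    nonzero even when \<open>c = 0\<close>.\<close>
  then have "eventually (\<lambda>j. (real (c + Suc j) / real (c + j)) ^ m * q < r \<and> j > 0) sequentially"
    using eventually_gt_at_top by (rule eventually_conj)
  then obtain N where N: "\<And>j. j \<ge> N \<Longrightarrow> (real (c + Suc j) / real (c + j)) ^ m * q < r \<and> j > 0"
    by (auto simp: eventually_sequentially)
  show ?thesis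
  proof (rule summable_ratio_test[OF r(2)])
    fix j assume "j \<ge> N"
    from N[OF this] have *: "real (c + Suc j) ^ m * q < r * real (c + j) ^ m"
      by (simp add: power_divide divide_simps split: if_splits)
    have "real (c + Suc j) ^ m * q * q ^ j \<le> r * real (c + j) ^ m * q ^ j"
      using * assms by (intro mult_right_mono) auto
    then show "norm (real (c + Suc j) ^ m * q ^ Suc j) \<le> r * norm (real (c + j) ^ m * q ^ j)"
      using assms by (simp add: abs_mult mult_ac)
  qed
qed

text \<open>
  The expansion in powers of \<open>\<epsilon>\<close> of the \<open>n\<close>-th Taylor coefficient of
  \<open>(1 - z) powr (\<beta> - 1) / (\<epsilon> + (1 - z) powr \<beta>) ^ k\<close>. For \<open>k = 0\<close> the truncated subtraction makes
  the binomial coefficient equal to \<open>1\<close> at \<open>j = 0\<close> and to \<open>0\<close> otherwise, as it should be.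
\<close>

definition resolvent_term :: "real \<Rightarrow> real \<Rightarrow> nat \<Rightarrow> nat \<Rightarrow> nat \<Rightarrow> real" where
  "resolvent_term \<beta> \<epsilon> k n j =
     real ((k + j - 1) choose j) * (- \<epsilon>) ^ j * rbinom (\<beta> * (real (k + j) - 1) + 1) n"

lemma summable_norm_resolvent_term:
  assumes "0 < \<beta>" "\<beta> \<le> 1" "0 \<le> \<epsilon>" "\<epsilon> < 1"
  shows "summable (\<lambda>j. norm (resolvent_term \<beta> \<epsilon> k n j))"
proof (cases k)
  case 0
  show ?thesis
    by (rule summable_finite[of "{0}"]) (auto simp: resolvent_term_def 0)
next
  case (Suc k')
  show ?thesis
  proof (rule summable_comparison_test')
    show "summable (\<lambda>j. real (k + j) ^ (k' + n) * \<epsilon> ^ j)"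
      using assms by (intro summable_power_mult_geometric)
    fix j :: nat
    let ?a = "\<beta> * (real (k + j) - 1)"
    have a: "0 \<le> ?a" "1 + ?a \<le> real (k + j)"
      using assms Suc mult_right_mono[of \<beta> 1 "real (k + j) - 1"] by auto
    \<comment> \<open>Symmetry moves the growing lower index \<open>j\<close> to the fixed index
      \<open>k'\<close>, so the binomial coefficient is polynomial in \<open>j\<close>.\<close>
    have "(k + j - 1) choose j = (k' + j) choose k'"
      using binomial_symmetric[of j "k' + j"] by (simp add: Suc)
    also have "\<dots> \<le> (k' + j) ^ k'"
      by (rule binomial_le_pow) simp
    also have "\<dots> \<le> (k + j) ^ k'"
      by (rule power_mono) (auto simp: Suc)
    finally have b: "real ((k + j - 1) choose j) \<le> real (k + j) ^ k'"
      by (metis of_nat_le_iff of_nat_power)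
    have c: "rbinom (?a + 1) n \<le> real (k + j) ^ n"
      using rbinom_le_power[OF a(1), of n] power_mono[OF a(2), of n] a(1) by linarith
    have "norm (norm (resolvent_term \<beta> \<epsilon> k n j)) =
        real ((k + j - 1) choose j) * rbinom (?a + 1) n * \<epsilon> ^ j"
      using assms a rbinom_nonneg[of "?a + 1" n]
      by (simp add: resolvent_term_def abs_mult power_abs)
    also have "\<dots> \<le> real (k + j) ^ k' * real (k + j) ^ n * \<epsilon> ^ j"
      using b c assms a(1) by (intro mult_mono rbinom_nonneg) auto
    finally show "norm (norm (resolvent_term \<beta> \<epsilon> k n j)) \<le> real (k + j) ^ (k' + n) * \<epsilon> ^ j"
      by (simp add: power_add)
  qed
qed

definition resolvent_coeff :: "real \<Rightarrow> real \<Rightarrow> nat \<Rightarrow> nat \<Rightarrow> real" where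
  "resolvent_coeff \<beta> \<epsilon> k n = (\<Sum>j. resolvent_term \<beta> \<epsilon> k n j)"

text \<open>With \<open>G k\<close> the function whose coefficients are
  \<open>resolvent_coeff \<beta> \<epsilon> k\<close>, this is
  \<open>((1 - z) powr \<beta> + \<epsilon>) * G (k + 1) = G k\<close> read off coefficientwise.
  Here \<open>x\<close> is the expansion in \<epsilon> of the \<open>n\<close>-th coefficient of
  \<open>(1 - z) powr \<beta> * G (k + 1)\<close>.\<close>

lemma resolvent_coeff_Suc:
  assumes "0 < \<beta>" "\<beta> \<le> 1" "0 \<le> \<epsilon>" "\<epsilon> < 1"
  shows "(\<Sum>i\<le>n. rbinom (- \<beta>) i * resolvent_coeff \<beta> \<epsilon> (Suc k) (n - i))
           + \<epsilon> * resolvent_coeff \<beta> \<epsilon> (Suc k) n = resolvent_coeff \<beta> \<epsilon> k n"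
proof -
  have sums: "resolvent_term \<beta> \<epsilon> k n sums resolvent_coeff \<beta> \<epsilon> k n" for k n
    unfolding resolvent_coeff_def
    by (intro summable_sums summable_norm_cancel[OF summable_norm_resolvent_term] assms)
  define x where "x = (\<lambda>j. real ((k + j) choose j) * (- \<epsilon>) ^ j * rbinom (\<beta> * (real (k + j) - 1) + 1) n)"
  have x_eq: "(\<Sum>i\<le>n. rbinom (- \<beta>) i * resolvent_term \<beta> \<epsilon> (Suc k) (n - i) j) = x j" for j
  proof -
    have "(\<Sum>i\<le>n. rbinom (- \<beta>) i * resolvent_term \<beta> \<epsilon> (Suc k) (n - i) j)
        = real ((k + j) choose j) * (- \<epsilon>) ^ j *
            (\<Sum>i\<le>n. rbinom (- \<beta>) i * rbinom (\<beta> * real (k + j) + 1) (n - i))"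
      by (simp add: resolvent_term_def sum_distrib_left mult_ac)
    also have "\<dots> = x j"
      unfolding rbinom_convolution x_def by (simp add: algebra_simps)
    finally show ?thesis .
  qed
  have "(\<lambda>j. \<Sum>i\<le>n. rbinom (- \<beta>) i * resolvent_term \<beta> \<epsilon> (Suc k) (n - i) j) sums
      (\<Sum>i\<le>n. rbinom (- \<beta>) i * resolvent_coeff \<beta> \<epsilon> (Suc k) (n - i))" (is "_ sums ?X")
    by (intro sums_sum sums_mult sums)
  then have X: "x sums ?X" by (simp only: x_eq)
  have x0: "x 0 = resolvent_term \<beta> \<epsilon> k n 0"
    by (simp add: x_def resolvent_term_def)
  have "(\<lambda>j. x (Suc j)) sums (?X - x 0)"
    using X by (subst sums_Suc_iff) simp
  from sums_add[OF this sums_mult[OF sums[of "Suc k" n], of \<epsilon>]]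
  have "(\<lambda>j. x (Suc j) + \<epsilon> * resolvent_term \<beta> \<epsilon> (Suc k) n j) sums
          (?X - x 0 + \<epsilon> * resolvent_coeff \<beta> \<epsilon> (Suc k) n)" .
  \<comment> \<open>Pascal's rule for the binomial coefficients; the shift by one in
    \<open>j\<close> absorbs the extra factor \<epsilon>.\<close>
  also have "(\<lambda>j. x (Suc j) + \<epsilon> * resolvent_term \<beta> \<epsilon> (Suc k) n j) =
      (\<lambda>j. resolvent_term \<beta> \<epsilon> k n (Suc j))"
    by (simp add: x_def resolvent_term_def fun_eq_iff algebra_simps)
  finally have "resolvent_term \<beta> \<epsilon> k n sums
      (?X - x 0 + \<epsilon> * resolvent_coeff \<beta> \<epsilon> (Suc k) n + resolvent_term \<beta> \<epsilon> k n 0)"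
    by (simp add: sums_Suc_iff)
  with sums[of k n] show ?thesis
    using sums_unique2 x0 by fastforce
qed

text \<open>The leading factor is \<open>- \<beta>\<close>, and all others are nonnegative since
  \<open>\<beta> \<le> 1\<close>. This is the source of all positivity below.\<close>

lemma rbinom_neg_nonpos:
  assumes "0 < \<beta>" "\<beta> \<le> 1" "i > 0"
  shows "rbinom (- \<beta>) i \<le> 0"
proof -
  obtain i' where i: "i = Suc i'" using assms(3) by (cases i) auto
  have "pochhammer (1 - \<beta>) i' \<ge> 0"
    using assms by (auto simp: pochhammer_prod intro!: prod_nonneg)
  then show ?thesis
    using assms by (auto simp: rbinom_def i pochhammer_rec intro!: divide_nonpos_nonneg mult_nonneg_nonneg)
qed

text \<open>The \<open>i = 0\<close> term of the recursion gives
  \<open>(1 + \<epsilon>) * R n\<close> as the coefficient for \<open>k\<close> minus terms with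
  factors \<open>rbinom (- \<beta>) i \<le> 0\<close> and earlier values of \<open>R\<close>. Hence
  induction on \<open>k\<close> and, inside it, on \<open>n\<close>; for \<open>k = 0\<close> only
  \<open>rbinom (1 - \<beta>) n\<close> is left.\<close>

lemma resolvent_coeff_nonneg:
  assumes "0 < \<beta>" "\<beta> \<le> 1" "0 \<le> \<epsilon>" "\<epsilon> < 1"
  shows "resolvent_coeff \<beta> \<epsilon> k n \<ge> 0"
proof (induction k arbitrary: n)
  case 0
  have "resolvent_coeff \<beta> \<epsilon> 0 n = (\<Sum>j\<in>{0}. resolvent_term \<beta> \<epsilon> 0 n j)"
    unfolding resolvent_coeff_def
    by (rule suminf_finite) (auto simp: resolvent_term_def)
  also have "\<dots> \<ge> 0"
    using assms by (simp add: resolvent_term_def rbinom_nonneg)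
  finally show ?case .
next
  case (Suc k)
  show ?case
  proof (induction n rule: less_induct)
    case (less n)
    let ?R = "resolvent_coeff \<beta> \<epsilon> (Suc k)"
    have "(\<Sum>i\<le>n. rbinom (- \<beta>) i * ?R (n - i)) = ?R n + (\<Sum>i\<in>{..n}-{0}. rbinom (- \<beta>) i * ?R (n - i))"
      by (subst sum.remove[of _ 0]) auto
    moreover have "(\<Sum>i\<in>{..n}-{0}. rbinom (- \<beta>) i * ?R (n - i)) \<le> 0"
      using rbinom_neg_nonpos[OF assms(1,2)] less.IH
      by (intro sum_nonpos mult_nonpos_nonneg) auto
    ultimately have "(1 + \<epsilon>) * ?R n \<ge> 0"
      using resolvent_coeff_Suc[OF assms, of k n] Suc[of n] by (simp add: algebra_simps)
    then show ?case using assms(3) by (simp add: zero_le_mult_iff)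
  qed
qed

lemma mittag_leffler_deriv_series_nonneg:
  assumes "0 < \<beta>" "\<beta> \<le> 1" "l > 0"
  shows "0 \<le> (\<Sum>j. real ((k + j) choose j) * (- l) ^ j / Gamma (\<beta> * real (k + j) + 1))"
proof -
  \<comment> \<open>With this choice \<open>(- \<epsilon> n) ^ j\<close> contributes
    \<open>(- l) ^ j\<close> and exactly the power of \<open>n\<close> that normalises the
    \<open>j\<close>-th term for \<open>rbinom_scaled_LIMSEQ\<close>.\<close>
  define \<epsilon> where "\<epsilon> = (\<lambda>n. l * real n powr - \<beta>)"
  define a where "a = (\<lambda>j n. real ((k + j) choose j) * (- l) ^ j *
      (rbinom (\<beta> * real (k + j) + 1) n * real n powr - (\<beta> * real (k + j))))"
  have a_eq: "a j n = real n powr - (\<beta> * real k) * resolvent_term \<beta> (\<epsilon> n) (Suc k) n j"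
    if "n > 0" for j n
  proof -
    have "(- \<epsilon> n) ^ j = (- l) ^ j * real n powr - (\<beta> * real j)"
      using that
      by (simp add: \<epsilon>_def power_minus[of "l * _"] power_minus[of l] power_mult_distrib
          flip: powr_realpow powr_powr) (simp add: powr_powr powr_power)
    moreover have "real n powr - (\<beta> * real (k + j)) =
        real n powr - (\<beta> * real k) * real n powr - (\<beta> * real j)"
      by (simp add: algebra_simps flip: powr_add)
    ultimately show ?thesis
      by (simp add: a_def resolvent_term_def)
  qed
  have "\<epsilon> \<longlonglongrightarrow> 0" unfolding \<epsilon>_def using assms by real_asymp
  then have "eventually (\<lambda>n. \<epsilon> n < 1) sequentially"
    by (rule order_tendstoD) simp
  then have "eventually (\<lambda>n. \<epsilon> n < 1 \<and> n > 0) sequentially"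
    using eventually_gt_at_top by (rule eventually_conj)
  then obtain N where N: "\<And>n. n \<ge> N \<Longrightarrow> \<epsilon> n < 1 \<and> n > 0"
    by (auto simp: eventually_sequentially)
  have \<epsilon>_nonneg: "\<epsilon> n \<ge> 0" for n using assms by (simp add: \<epsilon>_def)
  \<comment> \<open>The majorant is the sequence at the fixed index \<open>N\<close>: the norms
    decrease in \<open>n\<close>, and \<open>\<epsilon> N < 1\<close> makes it summable.\<close>
  have "((\<lambda>n. suminf (\<lambda>j. a j n)) \<longlonglongrightarrow>
      (\<Sum>j. real ((k + j) choose j) * (- l) ^ j * (1 / Gamma (\<beta> * real (k + j) + 1))))"
  proof (rule tannerys_theorem[THEN conjunct2, THEN conjunct2])
    show "a j \<longlonglongrightarrow> real ((k + j) choose j) * (- l) ^ j * (1 / Gamma (\<beta> * real (k + j) + 1))" for j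
      unfolding a_def using assms by (intro tendsto_intros rbinom_scaled_LIMSEQ) auto
    show "summable (\<lambda>j. norm (a j N))"
      using N[of N] assms \<epsilon>_nonneg
      by (auto simp: a_eq abs_mult intro!: summable_mult summable_norm_resolvent_term[simplified])
    have "norm (a j n) \<le> norm (a j N)" if "n \<ge> N" for j n
      unfolding a_def norm_mult
      using rbinom_scaled_antimono[of "\<beta> * real (k + j)" N n] that N[of N] assms
        rbinom_nonneg[of "\<beta> * real (k + j) + 1"]
      by (intro mult_left_mono) (auto simp: abs_mult)
    then show "\<forall>\<^sub>F (j, n) in at_top \<times>\<^sub>F sequentially. norm (a j n) \<le> norm (a j N)"
      by (intro eventually_mono[OF eventually_prodI[OF eventually_True eventually_ge_at_top[of N]]]) auto
  qed auto
  moreover have "eventually (\<lambda>n. 0 \<le> suminf (\<lambda>j. a j n)) sequentially"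
    using eventually_ge_at_top[of N]
  proof eventually_elim
    case (elim n)
    have "suminf (\<lambda>j. a j n) = real n powr - (\<beta> * real k) * resolvent_coeff \<beta> (\<epsilon> n) (Suc k) n"
      unfolding resolvent_coeff_def using N[OF elim] assms \<epsilon>_nonneg
      by (simp add: a_eq suminf_mult summable_norm_cancel[OF summable_norm_resolvent_term])
    also have "\<dots> \<ge> 0"
      using N[OF elim] assms \<epsilon>_nonneg by (intro mult_nonneg_nonneg resolvent_coeff_nonneg) auto
    finally show ?case .
  qed
  ultimately have "0 \<le> (\<Sum>j. real ((k + j) choose j) * (- l) ^ j * (1 / Gamma (\<beta> * real (k + j) + 1)))"
    by (rule tendsto_lowerbound) simp
  then show ?thesis by simp
qed

section \<open>Factorial moments\<close>

text \<open>The limit of a decreasing sequence is at most its \<open>N\<close>-th term. As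
  \<open>N\<close> is free, \<open>1 / Gamma\<close> decays faster than any exponential, with no
  appeal to Stirling's formula.\<close>

lemma inverse_Gamma_le:
  assumes "a \<ge> 0" "N > 0"
  shows "1 / Gamma (a + 1) \<le> (1 + a) ^ N * real N powr - a"
proof (rule tendsto_upperbound[OF rbinom_scaled_LIMSEQ[OF assms(1)]])
  show "eventually (\<lambda>n. rbinom (a + 1) n * real n powr - a \<le> (1 + a) ^ N * real N powr - a) sequentially"
    using eventually_ge_at_top[of N]
  proof eventually_elim
    case (elim n)
    then show ?case
      using rbinom_scaled_antimono[OF assms elim]
        mult_right_mono[OF rbinom_le_power[OF assms(1), of N], of "real N powr - a"] by simp
  qed
qed simp

section \<open>The Mittag-Leffler function as an entire power series\<close>

definition mittag_leffler_fps :: "real \<Rightarrow> complex fps" where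
  "mittag_leffler_fps \<beta> = Abs_fps (\<lambda>n. of_real (1 / Gamma (\<beta> * real n + 1)))"

lemma summable_mittag_leffler:
  assumes "0 < \<beta>" "\<beta> \<le> 1"
  shows "summable (\<lambda>n. fps_nth (mittag_leffler_fps \<beta>) n * z ^ n)"
proof -
  have "(\<lambda>n. norm z * real n powr - \<beta>) \<longlonglongrightarrow> 0"
    using assms by real_asymp
  then have "eventually (\<lambda>n. norm z * real n powr - \<beta> < 1) sequentially"
    by (rule order_tendstoD) simp
  then have "eventually (\<lambda>n. norm z * real n powr - \<beta> < 1 \<and> n > 0) sequentially"
    using eventually_gt_at_top by (rule eventually_conj)
  \<comment> \<open>\<open>N\<close> depends on \<open>z\<close>: the bound on
    \<open>1 / Gamma\<close> then leaves a polynomial times a convergent geometric series.\<close>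
  then obtain N where N: "norm z * real N powr - \<beta> < 1" "N > 0"
    by (auto simp: eventually_sequentially)
  show ?thesis
  proof (rule summable_comparison_test')
    show "summable (\<lambda>j. real (1 + j) ^ N * (norm z * real N powr - \<beta>) ^ j)"
      using N by (intro summable_power_mult_geometric) auto
    fix j :: nat
    have "1 + \<beta> * real j \<le> real (1 + j)"
      using assms mult_right_mono[of \<beta> 1 "real j"] by auto
    then have "(1 + \<beta> * real j) ^ N \<le> real (1 + j) ^ N"
      using assms by (intro power_mono) auto
    then have "(1 + \<beta> * real j) ^ N * real N powr - (\<beta> * real j) \<le> real (1 + j) ^ N * real N powr - (\<beta> * real j)"
      by (rule mult_right_mono) simp
    then have "1 / Gamma (\<beta> * real j + 1) \<le> real (1 + j) ^ N * real N powr - (\<beta> * real j)"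
      using inverse_Gamma_le[of "\<beta> * real j" N] assms N by (smt (verit) mult_nonneg_nonneg of_nat_0_le_iff)
    then have "1 / Gamma (\<beta> * real j + 1) * norm z ^ j \<le>
        real (1 + j) ^ N * real N powr - (\<beta> * real j) * norm z ^ j"
      by (rule mult_right_mono) simp
    also have "real N powr - (\<beta> * real j) = (real N powr - \<beta>) ^ j"
      using N by (simp add: powr_powr flip: powr_realpow)
    finally show "norm (fps_nth (mittag_leffler_fps \<beta>) j * z ^ j) \<le>
        real (1 + j) ^ N * (norm z * real N powr - \<beta>) ^ j"
      using assms Gamma_real_pos[of "\<beta> * real j + 1"]
      by (simp add: abs_of_pos mittag_leffler_fps_def norm_mult norm_power norm_divide
          power_mult_distrib mult_ac add_nonneg_pos)
  qed
qed

lemma fps_conv_radius_mittag_leffler: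
  assumes "0 < \<beta>" "\<beta> \<le> 1"
  shows "fps_conv_radius (mittag_leffler_fps \<beta>) = \<infinity>"
  unfolding fps_conv_radius_def
  by (rule conv_radius_inftyI'') (rule summable_mittag_leffler[OF assms])

lemma mittag_leffler_eq_eval_fps: "mittag_leffler \<beta> = eval_fps (mittag_leffler_fps \<beta>)"
  by (simp add: fun_eq_iff mittag_leffler_def eval_fps_def mittag_leffler_fps_def field_simps)

lemma fps_conv_radius_higher_deriv:
  fixes F :: "complex fps"
  assumes "fps_conv_radius F = \<infinity>"
  shows "fps_conv_radius ((fps_deriv ^^ k) F) = \<infinity>"
proof (induction k)
  case (Suc k)
  then show ?case using fps_conv_radius_deriv[of "(fps_deriv ^^ k) F"] by simp
qed (simp add: assms)

lemma higher_deriv_eval_fps: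
  fixes F :: "complex fps"
  assumes "fps_conv_radius F = \<infinity>"
  shows "(deriv ^^ k) (eval_fps F) = eval_fps ((fps_deriv ^^ k) F)"
proof (induction k)
  case (Suc k)
  have "deriv (eval_fps ((fps_deriv ^^ k) F)) z = eval_fps (fps_deriv ((fps_deriv ^^ k) F)) z" for z
    by (rule eval_fps_deriv[symmetric]) (simp add: fps_conv_radius_higher_deriv[OF assms])
  then show ?case by (simp add: Suc fun_eq_iff)
qed simp

lemma fps_nth_higher_deriv:
  fixes F :: "'a::field_char_0 fps"
  shows "fps_nth ((fps_deriv ^^ k) F) n = fact k * of_nat ((k + n) choose n) * fps_nth F (k + n)"
proof (induction k arbitrary: n)
  case (Suc k)
  have "Suc n * ((k + Suc n) choose Suc n) = Suc k * ((Suc k + n) choose n)"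
  proof -
    have "Suc n * ((k + Suc n) choose Suc n) = (Suc k + n) * ((k + n) choose n)"
      using Suc_times_binomial_eq[of "k + n" n] by (simp add: ac_simps)
    also have "\<dots> = Suc k * ((Suc k + n) choose n)"
      using binomial_absorb_comp[of "Suc k + n" n] by simp
    finally show ?thesis .
  qed
  then have *: "of_nat (Suc n) * of_nat ((k + Suc n) choose Suc n) =
      (of_nat (Suc k) * of_nat ((Suc k + n) choose n) :: 'a)"
    by (metis of_nat_mult)
  have "fps_nth ((fps_deriv ^^ Suc k) F) n =
      of_nat (Suc n) * (fact k * of_nat ((k + Suc n) choose Suc n) * fps_nth F (k + Suc n))"
    by (simp add: Suc del: of_nat_Suc)
  also have "\<dots> = fact k * (of_nat (Suc n) * of_nat ((k + Suc n) choose Suc n)) * fps_nth F (Suc k + n)"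
    by (simp only: mult_ac add_Suc add_Suc_right)
  also have "\<dots> = fact (Suc k) * of_nat ((Suc k + n) choose n) * fps_nth F (Suc k + n)"
    unfolding * by (simp add: algebra_simps)
  finally show ?case .
qed simp

lemma higher_deriv_mittag_leffler_sums:
  assumes "0 < \<beta>" "\<beta> \<le> 1"
  shows "(\<lambda>j. fact k * of_nat ((k + j) choose j) * of_real (1 / Gamma (\<beta> * real (k + j) + 1)) * z ^ j)
           sums (deriv ^^ k) (mittag_leffler \<beta>) z"
proof -
  note rad = fps_conv_radius_mittag_leffler[OF assms]
  have "(\<lambda>j. fps_nth ((fps_deriv ^^ k) (mittag_leffler_fps \<beta>)) j * z ^ j) sums
      eval_fps ((fps_deriv ^^ k) (mittag_leffler_fps \<beta>)) z"
    by (rule sums_eval_fps) (simp add: fps_conv_radius_higher_deriv[OF rad])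
  then show ?thesis
    by (simp add: fps_nth_higher_deriv mittag_leffler_eq_eval_fps higher_deriv_eval_fps[OF rad])
       (simp add: mittag_leffler_fps_def)
qed

lemma higher_deriv_mittag_leffler_nonneg:
  assumes "0 < \<beta>" "\<beta> \<le> 1" "l > 0"
  shows "(deriv ^^ k) (mittag_leffler \<beta>) (- of_real l) =
           of_real (Re ((deriv ^^ k) (mittag_leffler \<beta>) (- of_real l)))"
    and "0 \<le> Re ((deriv ^^ k) (mittag_leffler \<beta>) (- of_real l))"
proof -
  let ?s = "\<lambda>j. real ((k + j) choose j) * (- l) ^ j / Gamma (\<beta> * real (k + j) + 1)"
  have "(\<lambda>j. fact k * of_nat ((k + j) choose j) * of_real (1 / Gamma (\<beta> * real (k + j) + 1)) *
          (- complex_of_real l) ^ j)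
      = (\<lambda>j. complex_of_real (fact k * ?s j))"
    by (simp add: fun_eq_iff)
  with higher_deriv_mittag_leffler_sums[OF assms(1,2), of k "- of_real l"]
  have 1: "(\<lambda>j. complex_of_real (fact k * ?s j)) sums (deriv ^^ k) (mittag_leffler \<beta>) (- of_real l)"
    by simp
  then have "summable (\<lambda>j. fact k * ?s j)"
    using sums_summable summable_of_real_iff by blast
  then have sums: "(\<lambda>j. fact k * ?s j) sums (fact k * suminf ?s)"
    using suminf_mult[of ?s "fact k :: real"] summable_cmult_iff[of "fact k :: real" ?s] summable_sums
    by fastforce
  have eq: "(deriv ^^ k) (mittag_leffler \<beta>) (- of_real l) = of_real (fact k * suminf ?s)"
    using sums_unique2[OF 1] sums_of_real[OF sums] by blast
  show "(deriv ^^ k) (mittag_leffler \<beta>) (- of_real l) =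
           of_real (Re ((deriv ^^ k) (mittag_leffler \<beta>) (- of_real l)))"
    unfolding eq by simp
  show "0 \<le> Re ((deriv ^^ k) (mittag_leffler \<beta>) (- of_real l))"
    unfolding eq Re_complex_of_real
    by (intro mult_nonneg_nonneg mittag_leffler_deriv_series_nonneg assms) auto
qed

section \<open>Weights of the fractional Poisson measure and their factorial moments\<close>

definition fractional_poisson_weight :: "real \<Rightarrow> real \<Rightarrow> nat \<Rightarrow> real" where
  "fractional_poisson_weight l \<beta> k =
     l ^ k / fact k * Re ((deriv ^^ k) (mittag_leffler \<beta>) (- of_real l))"

lemma fractional_poisson_weight_nonneg:
  assumes "0 < \<beta>" "\<beta> \<le> 1" "l > 0"
  shows "fractional_poisson_weight l \<beta> k \<ge> 0"
  using assms higher_deriv_mittag_leffler_nonneg(2)[OF assms]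
  by (simp add: fractional_poisson_weight_def)

text \<open>Expand the \<open>r\<close>-th derivative of the Mittag-Leffler function at
  \<open>- l\<close>, evaluate at 0 and multiply by \<open>l ^ r / fact r\<close>: the summands
  become weights times binomial coefficients. For \<open>r = 0\<close> the total mass is 1.\<close>

lemma factorial_moment_sums:
  assumes "0 < \<beta>" "\<beta> \<le> 1" "l > 0"
  shows "(\<lambda>k. fractional_poisson_weight l \<beta> k * real (k choose r)) sums (l ^ r / Gamma (\<beta> * real r + 1))"
proof -
  let ?E = "mittag_leffler \<beta>" and ?w = "fractional_poisson_weight l \<beta>"
  \<comment> \<open>The radius \<open>l + 1\<close> puts the evaluation point 0 inside the
    ball.\<close>
  have holo: "(deriv ^^ r) ?E holomorphic_on ball (- of_real l) (l + 1)"
    unfolding mittag_leffler_eq_eval_fps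
      higher_deriv_eval_fps[OF fps_conv_radius_mittag_leffler[OF assms(1,2)]]
    by (rule holomorphic_on_eval_fps)
      (simp add: fps_conv_radius_higher_deriv fps_conv_radius_mittag_leffler assms)
  have "(\<lambda>n. (deriv ^^ n) ((deriv ^^ r) ?E) (- of_real l) / fact n * (0 - - of_real l) ^ n)
      sums (deriv ^^ r) ?E 0"
    using assms by (intro holomorphic_power_series[OF holo]) simp
  from sums_mult[OF this, of "of_real (l ^ r / fact r)"]
  have "(\<lambda>n. of_real (l ^ r / fact r) * ((deriv ^^ (n + r)) ?E (- of_real l) / fact n * of_real l ^ n))
      sums (of_real (l ^ r / fact r) * (deriv ^^ r) ?E 0)"
    by (simp add: funpow_add)
  also have "(\<lambda>n. of_real (l ^ r / fact r) * ((deriv ^^ (n + r)) ?E (- of_real l) / fact n * of_real l ^ n))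
      = (\<lambda>n. complex_of_real (?w (n + r) * real ((n + r) choose r)))"
  proof
    fix n
    have "of_real (l ^ r / fact r) * ((deriv ^^ (n + r)) ?E (- of_real l) / fact n * of_real l ^ n) =
        complex_of_real (l ^ (n + r) / (fact r * fact n) * Re ((deriv ^^ (n + r)) ?E (- of_real l)))"
      by (subst higher_deriv_mittag_leffler_nonneg(1)[OF assms]) (simp add: power_add)
    also have "l ^ (n + r) / (fact r * fact n) * Re ((deriv ^^ (n + r)) ?E (- of_real l)) =
        ?w (n + r) * real ((n + r) choose r)"
      by (simp add: fractional_poisson_weight_def binomial_fact)
    finally show "of_real (l ^ r / fact r) * ((deriv ^^ (n + r)) ?E (- of_real l) / fact n * of_real l ^ n)
      = complex_of_real (?w (n + r) * real ((n + r) choose r))" .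
  qed
  also have "(deriv ^^ r) ?E 0 = fact r * of_real (1 / Gamma (\<beta> * real r + 1))"
  proof -
    have "(\<lambda>j. fact r * of_nat ((r + j) choose j) * of_real (1 / Gamma (\<beta> * real (r + j) + 1)) * 0 ^ j)
        sums (\<Sum>j\<in>{0}. fact r * of_nat ((r + j) choose j) * complex_of_real (1 / Gamma (\<beta> * real (r + j) + 1)) * 0 ^ j)"
      by (rule sums_finite) auto
    from sums_unique2[OF higher_deriv_mittag_leffler_sums[OF assms(1,2), of r 0] this]
    show ?thesis by simp
  qed
  also have "of_real (l ^ r / fact r) * (fact r * of_real (1 / Gamma (\<beta> * real r + 1))) =
      complex_of_real (l ^ r / Gamma (\<beta> * real r + 1))"
    by simp
  finally have "(\<lambda>n. ?w (n + r) * real ((n + r) choose r)) sums (l ^ r / Gamma (\<beta> * real r + 1))"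
    by (simp only: sums_of_real_iff)
  then show ?thesis
    by (subst (asm) sums_iff_shift) (simp add: binomial_eq_0)
qed

lemma fractional_poisson_altdef:
  "fractional_poisson l \<beta> =
     distr (density (count_space UNIV) (\<lambda>k. ennreal (fractional_poisson_weight l \<beta> k))) borel real"
  by (simp add: fractional_poisson_def fractional_poisson_weight_def)

lemma integrable_fractional_poisson_iff:
  fixes f :: "real \<Rightarrow> complex"
  assumes "0 < \<beta>" "\<beta> \<le> 1" "l > 0" and [measurable]: "f \<in> borel_measurable borel"
  shows "integrable (fractional_poisson l \<beta>) f \<longleftrightarrow>
           summable (\<lambda>k. norm (fractional_poisson_weight l \<beta> k *\<^sub>R f (real k)))"
  unfolding fractional_poisson_altdef
  by (subst integrable_distr_eq, measurable)
    (simp add: integrable_density integrable_count_space_nat_iff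
      fractional_poisson_weight_nonneg[OF assms(1-3)] del: norm_scaleR)

lemma integral_fractional_poisson:
  fixes f :: "real \<Rightarrow> complex"
  assumes "0 < \<beta>" "\<beta> \<le> 1" "l > 0" and [measurable]: "f \<in> borel_measurable borel"
    and "integrable (fractional_poisson l \<beta>) f"
  shows "(\<integral>x. f x \<partial>fractional_poisson l \<beta>) = (\<Sum>k. fractional_poisson_weight l \<beta> k *\<^sub>R f (real k))"
proof -
  have "(\<integral>x. f x \<partial>fractional_poisson l \<beta>) =
      (\<integral>k. fractional_poisson_weight l \<beta> k *\<^sub>R f (real k) \<partial>count_space UNIV)"
    unfolding fractional_poisson_altdef
    by (subst integral_distr, measurable)
      (simp add: integral_density fractional_poisson_weight_nonneg[OF assms(1-3)])
  also have "\<dots> = (\<Sum>k. fractional_poisson_weight l \<beta> k *\<^sub>R f (real k))"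
    using assms(5) unfolding integrable_fractional_poisson_iff[OF assms(1-4)]
    by (intro integral_count_space_nat) (simp add: integrable_count_space_nat_iff)
  finally show ?thesis .
qed

section \<open>Binomial polynomials and their integrals\<close>

definition binom_poly :: "nat \<Rightarrow> complex poly" where
  "binom_poly r = smult (1 / fact r) (\<Prod>i<r. [:- of_nat i, 1:])"

lemma poly_binom_poly: "poly (binom_poly r) x = x gchoose r"
  by (simp add: binom_poly_def poly_prod gbinomial_prod_rev lessThan_atLeast0)

lemma binom_poly_0 [simp]: "binom_poly 0 = 1"
  by (simp add: binom_poly_def)



text \<open>Multiplication by the variable in the binomial basis; it drives the inductions for
  integrability and for the action of \<open>g_nabla_pow\<close>.\<close>

lemma pCons_0_binom_poly:
  "pCons 0 (binom_poly r) = smult (of_nat (Suc r)) (binom_poly (Suc r)) + smult (of_nat r) (binom_poly r)"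
proof -
  have "x * (x gchoose r) = of_nat (Suc r) * (x gchoose Suc r) + of_nat r * (x gchoose r)" for x :: complex
    using gbinomial_mult_1[of x r] by (simp add: algebra_simps)
  then have "poly (pCons 0 (binom_poly r)) =
      poly (smult (of_nat (Suc r)) (binom_poly (Suc r)) + smult (of_nat r) (binom_poly r))"
    by (simp add: fun_eq_iff poly_binom_poly del: of_nat_Suc)
  then show ?thesis by (simp only: poly_eq_poly_eq_iff)
qed

lemma borel_measurable_poly_of_real [measurable]:
  "(\<lambda>x::real. poly p (of_real x) :: complex) \<in> borel_measurable borel"
  by (intro borel_measurable_continuous_onI continuous_intros)

lemma factorial_moment_integral:
  assumes "0 < \<beta>" "\<beta> \<le> 1" "l > 0"
  shows "integrable (fractional_poisson l \<beta>) (\<lambda>x. poly (binom_poly r) (of_real x))"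
    and "(\<integral>x. poly (binom_poly r) (of_real x) \<partial>fractional_poisson l \<beta>) =
           of_real (l ^ r / Gamma (\<beta> * real r + 1))"
proof -
  have eq: "poly (binom_poly r) (of_real (real k)) = of_real (real (k choose r))" for k
    by (simp add: poly_binom_poly flip: binomial_gbinomial)
  note sums = factorial_moment_sums[OF assms, of r]
  show int: "integrable (fractional_poisson l \<beta>) (\<lambda>x. poly (binom_poly r) (of_real x))"
    unfolding integrable_fractional_poisson_iff[OF assms borel_measurable_poly_of_real] eq
    using sums_summable[OF sums] fractional_poisson_weight_nonneg[OF assms]
    by (simp add: norm_mult)
  show "(\<integral>x. poly (binom_poly r) (of_real x) \<partial>fractional_poisson l \<beta>) =
           of_real (l ^ r / Gamma (\<beta> * real r + 1))"
    unfolding integral_fractional_poisson[OF assms borel_measurable_poly_of_real int] eq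
    using sums_unique[OF sums_of_real[OF sums, where 'a = complex]]
    by (simp add: scaleR_conv_of_real)
qed

lemma integrable_poly_fractional_poisson:
  fixes p :: "complex poly"
  assumes "0 < \<beta>" "\<beta> \<le> 1" "l > 0"
  shows "integrable (fractional_poisson l \<beta>) (\<lambda>x. poly p (of_real x))"
proof -
  \<comment> \<open>The factor \<open>binom_poly r\<close> strengthens the induction: a factor of
    the variable is absorbed into it, so no change of basis is needed.\<close>
  have "integrable (fractional_poisson l \<beta>) (\<lambda>x. poly (p * binom_poly r) (of_real x))" for r
  proof (induction p arbitrary: r)
    case (pCons a p)
    have "pCons a p * binom_poly r = smult a (binom_poly r) + p * pCons 0 (binom_poly r)"
      by simp
    also have "\<dots> = smult a (binom_poly r) +
        smult (of_nat (Suc r)) (p * binom_poly (Suc r)) + smult (of_nat r) (p * binom_poly r)"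
      unfolding pCons_0_binom_poly by (simp add: algebra_simps)
    finally show ?case
      using pCons.IH[of r] pCons.IH[of "Suc r"] factorial_moment_integral(1)[OF assms, of r]
      by (simp del: poly_mult of_nat_Suc mult_pCons_left)
  qed simp
  from this[of 0] show ?thesis by simp
qed

section \<open>The operators and the Appell polynomials\<close>

lemma smult_sum_right: "smult c (sum f A) = (\<Sum>x\<in>A. smult c (f x))"
  by (induction A rule: infinite_finite_induct) (simp_all add: smult_add_right)

text \<open>Terms below \<open>k\<close> vanish with the Stirling number, terms above the degree
  with the derivative. A common bound \<open>N\<close> makes the sums for different polynomials
  comparable.\<close>

lemma g_nabla_pow_eq:
  assumes "degree p \<le> N"
  shows "g_nabla_pow k p = (\<Sum>n\<le>N. smult (fact k * of_nat (Stirling n k) / fact n) ((pderiv ^^ n) p))"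
proof -
  have zero: "(pderiv ^^ n) p = 0" if "n > degree p" for n
    by (rule poly_eqI) (use that in \<open>simp add: coeff_higher_pderiv coeff_eq_0\<close>)
  have "(\<Sum>n\<le>N. smult (fact k * of_nat (Stirling n k) / fact n) ((pderiv ^^ n) p)) =
      (\<Sum>n=k..degree p. smult (fact k * of_nat (Stirling n k) / fact n) ((pderiv ^^ n) p))"
    using assms by (intro sum.mono_neutral_right) (auto simp: zero not_le)
  also have "\<dots> = g_nabla_pow k p"
    by (simp add: g_nabla_pow_def smult_sum_right)
  finally show ?thesis ..
qed

lemma g_nabla_pow_add: "g_nabla_pow k (p + q) = g_nabla_pow k p + g_nabla_pow k q"
proof -
  let ?N = "max (degree p) (degree q)"
  have "degree (p + q) \<le> ?N" by (rule degree_add_le_max)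
  then show ?thesis
    by (simp add: g_nabla_pow_eq[of _ ?N] higher_pderiv_add smult_add_right sum.distrib)
qed

lemma g_nabla_pow_smult: "g_nabla_pow k (smult c p) = smult c (g_nabla_pow k p)"
  by (simp add: g_nabla_pow_eq[of p "degree p"] g_nabla_pow_eq[of "smult c p" "degree p"]
      degree_smult_le higher_pderiv_smult smult_sum_right mult.commute)

lemma g_nabla_pow_zero: "g_nabla_pow k 0 = 0"
  using g_nabla_pow_smult[of k 0 0] by simp

lemma g_nabla_pow_sum: "g_nabla_pow k (sum f A) = (\<Sum>x\<in>A. g_nabla_pow k (f x))"
  by (induction A rule: infinite_finite_induct) (simp_all add: g_nabla_pow_zero g_nabla_pow_add)

text \<open>Leibniz's rule for a product with the variable; at \<open>n = 0\<close> the truncated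
  \<open>n - 1\<close> is harmless since its factor is 0.\<close>

lemma higher_pderiv_pCons_0:
  fixes p :: "'a::{comm_semiring_1,semiring_no_zero_divisors,semiring_char_0} poly"
  shows "(pderiv ^^ n) (pCons 0 p) = pCons 0 ((pderiv ^^ n) p) + smult (of_nat n) ((pderiv ^^ (n - 1)) p)"
proof (induction n)
  case (Suc n)
  show ?case
  proof (cases n)
    case (Suc m)
    show ?thesis
      unfolding funpow.simps(2) o_apply Suc.IH
      using Suc by (simp add: pderiv_pCons pderiv_add pderiv_smult smult_add_left add_ac)
  qed (simp add: pderiv_pCons add.commute)
qed simp

text \<open>
  This is the Pincherle derivative: for an operator \<open>f(\<nabla>)\<close> and multiplication by the variable \<open>x\<close>
  one has \<open>f(\<nabla>) x - x f(\<nabla>) = f'(\<nabla>)\<close>, and the derivative of \<open>g ^ k\<close> is \<open>k (g ^ k + g ^ (k - 1))\<close>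
  for \<open>g(z) = exp z - 1\<close>.
\<close>

lemma g_nabla_pow_pCons_0:
  "g_nabla_pow k (pCons 0 p) =
     pCons 0 (g_nabla_pow k p) + smult (of_nat k) (g_nabla_pow k p + g_nabla_pow (k - 1) p)"
proof -
  let ?N = "degree p" and ?D = "\<lambda>n. (pderiv ^^ n) p"
  let ?c = "\<lambda>k n. fact k * of_nat (Stirling n k) / fact n :: complex"
  have "g_nabla_pow k (pCons 0 p) =
      (\<Sum>n\<le>Suc ?N. smult (?c k n) (pCons 0 (?D n) + smult (of_nat n) (?D (n - 1))))"
    by (subst g_nabla_pow_eq[of _ "Suc ?N"]) (auto simp: degree_pCons_eq_if higher_pderiv_pCons_0)
  also have "\<dots> = (\<Sum>n\<le>Suc ?N. smult (?c k n) (pCons 0 (?D n))) +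
      (\<Sum>n\<le>Suc ?N. smult (?c k n * of_nat n) (?D (n - 1)))"
    by (simp add: smult_add_right sum.distrib del: sum.atMost_Suc)
  also have "(\<Sum>n\<le>Suc ?N. smult (?c k n) (pCons 0 (?D n))) =
      [:0, 1:] * (\<Sum>n\<le>Suc ?N. smult (?c k n) (?D n))"
    by (simp add: sum_distrib_left del: sum.atMost_Suc)
  also have "(\<Sum>n\<le>Suc ?N. smult (?c k n) (?D n)) = g_nabla_pow k p"
    by (rule g_nabla_pow_eq[symmetric]) simp
  also have "(\<Sum>n\<le>Suc ?N. smult (?c k n * of_nat n) (?D (n - 1))) =
      (\<Sum>n\<le>?N. smult (?c k (Suc n) * of_nat (Suc n)) (?D n))"
    by (subst sum.atMost_Suc_shift) simp
  also have "\<dots> = (\<Sum>n\<le>?N. smult (of_nat k * (?c k n + ?c (k - 1) n)) (?D n))"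
  proof (intro sum.cong refl arg_cong2[where f = smult])
    fix n
    \<comment> \<open>The Stirling recurrence does the work; for \<open>k = 0\<close> both sides
      vanish, so the truncated \<open>k - 1\<close> does not matter.\<close>
    have "?c k (Suc n) * of_nat (Suc n) = fact k * of_nat (Stirling (Suc n) k) / fact n"
      by (simp add: field_simps del: of_nat_Suc Stirling.simps)
    also have "\<dots> = of_nat k * (?c k n + ?c (k - 1) n)"
      by (cases k) (simp_all add: field_simps)
    finally show "?c k (Suc n) * of_nat (Suc n) = of_nat k * (?c k n + ?c (k - 1) n)" .
  qed
  also have "\<dots> = smult (of_nat k) (g_nabla_pow k p + g_nabla_pow (k - 1) p)"
    by (simp add: g_nabla_pow_eq[of p ?N] smult_sum_right smult_add_right smult_add_left
        ring_distribs sum.distrib)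
  finally show ?thesis by simp
qed

lemma g_nabla_pow_one: "g_nabla_pow k 1 = (if k = 0 then 1 else 0)"
  by (cases k) (simp_all add: g_nabla_pow_def)

text \<open>Write \<open>(n + 1) (x gchoose (n + 1))\<close> as \<open>(x - n) (x gchoose n)\<close>
  and commute the operator past \<open>x\<close> by \<open>g_nabla_pow_pCons_0\<close>. That formula
  also involves \<open>k - 1\<close>, so \<open>k\<close> is arbitrary in the induction.\<close>

lemma g_nabla_pow_binom_poly:
  "g_nabla_pow k (binom_poly n) = (if k \<le> n then binom_poly (n - k) else 0)"
proof (induction n arbitrary: k)
  case 0
  then show ?case by (simp add: g_nabla_pow_one)
next
  case (Suc n)
  let ?c = "of_nat (Suc n) :: complex"
  have "smult ?c (binom_poly (Suc n)) = pCons 0 (binom_poly n) + smult (- of_nat n) (binom_poly n)"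
    by (simp add: pCons_0_binom_poly del: of_nat_Suc)
  then have "smult ?c (g_nabla_pow k (binom_poly (Suc n))) =
      g_nabla_pow k (pCons 0 (binom_poly n)) + smult (- of_nat n) (g_nabla_pow k (binom_poly n))"
    by (metis g_nabla_pow_add g_nabla_pow_smult)
  also have "\<dots> = smult ?c (if k \<le> Suc n then binom_poly (Suc n - k) else 0)"
  proof (cases "k \<le> n")
    case True
    then obtain d where n: "n = k + d" using le_Suc_ex by blast
    show ?thesis
    proof (cases k)
      case 0
      then show ?thesis
        unfolding g_nabla_pow_pCons_0 Suc.IH by (simp add: pCons_0_binom_poly del: of_nat_Suc)
    next
      case (Suc k')
      have "n - k' = Suc d" "n - k = d" "k \<le> n" "k' \<le> n" "Suc n - k = Suc d" "k - 1 = k'" "k \<le> Suc n"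
        using n Suc by auto
      then show ?thesis
        unfolding g_nabla_pow_pCons_0 Suc.IH
        by (simp add: pCons_0_binom_poly n smult_add_right del: of_nat_Suc)
          (simp add: smult_add_left[symmetric] algebra_simps)
    qed
  next
    case False
    then show ?thesis
      by (cases "k = Suc n") (auto simp: g_nabla_pow_pCons_0 Suc.IH)
  qed
  finally have "smult (1 / ?c) (smult ?c (g_nabla_pow k (binom_poly (Suc n)))) =
      smult (1 / ?c) (smult ?c (if k \<le> Suc n then binom_poly (Suc n - k) else 0))"
    by (rule arg_cong)
  moreover have "1 / ?c * ?c = 1" by (simp del: of_nat_Suc)
  ultimately show ?case by (simp only: smult_smult smult_1_left)
qed

section \<open>The Appell polynomials from their generating function\<close>

definition scaled_mittag_leffler_fps :: "real \<Rightarrow> real \<Rightarrow> complex fps" where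
  "scaled_mittag_leffler_fps l \<beta> = Abs_fps (\<lambda>n. of_real (l ^ n / Gamma (\<beta> * real n + 1)))"

lemma scaled_mittag_leffler_has_fps_expansion:
  assumes "0 < \<beta>" "\<beta> \<le> 1"
  shows "(\<lambda>z. mittag_leffler \<beta> (of_real l * z)) has_fps_expansion scaled_mittag_leffler_fps l \<beta>"
proof -
  have term_eq: "fps_nth (scaled_mittag_leffler_fps l \<beta>) n * z ^ n =
      fps_nth (mittag_leffler_fps \<beta>) n * (of_real l * z) ^ n" for n z
    by (simp add: scaled_mittag_leffler_fps_def mittag_leffler_fps_def power_mult_distrib)
  have "fps_conv_radius (scaled_mittag_leffler_fps l \<beta>) = \<infinity>"
    unfolding fps_conv_radius_def
    by (rule conv_radius_inftyI'') (simp add: term_eq summable_mittag_leffler assms)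
  then show ?thesis
    by (simp add: has_fps_expansion_def mittag_leffler_eq_eval_fps eval_fps_def term_eq)
qed

lemma scaled_mittag_leffler_fps_nth_0: "fps_nth (scaled_mittag_leffler_fps l \<beta>) 0 = 1"
  by (simp add: scaled_mittag_leffler_fps_def)

lemma gen_appell_eq:
  assumes "0 < \<beta>" "\<beta> \<le> 1"
  shows "gen_appell l \<beta> = (\<lambda>n. smult (fact n)
           (\<Sum>j\<le>n. smult (fps_nth (inverse (scaled_mittag_leffler_fps l \<beta>)) j) (binom_poly (n - j))))"
    (is "_ = ?C")
proof -
  let ?A = "inverse (scaled_mittag_leffler_fps l \<beta>)"
  let ?f = "\<lambda>x z. exp (of_real x * Ln (1 + z)) / mittag_leffler \<beta> (of_real l * z)"
  have A: "(\<lambda>z. inverse (mittag_leffler \<beta> (of_real l * z))) has_fps_expansion ?A"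
    by (intro has_fps_expansion_inverse scaled_mittag_leffler_has_fps_expansion assms)
      (simp add: scaled_mittag_leffler_fps_nth_0)
  \<comment> \<open>Existence: multiply the series of the reciprocal Mittag-Leffler function by the
    binomial series of \<open>(1 + z) powr x\<close>. The latter converges on the unit disc for
    every \<open>x\<close>, so one neighbourhood serves all \<open>x\<close>.\<close>
  have C: "\<forall>\<^sub>F z in nhds 0. \<forall>x::real. (\<lambda>n. z ^ n / fact n * poly (?C n) (of_real x)) sums ?f x z"
  proof -
    have "\<forall>\<^sub>F z in nhds 0. z \<in> eball (0::complex) (min 1 (fps_conv_radius ?A))"
      using A by (intro eventually_nhds_in_open) (auto simp: has_fps_expansion_def zero_ereal_def)
    moreover have "\<forall>\<^sub>F z in nhds 0. eval_fps ?A z = inverse (mittag_leffler \<beta> (of_real l * z))"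
      using A by (simp add: has_fps_expansion_def)
    ultimately show ?thesis
    proof eventually_elim
      case (elim z)
      show ?case
      proof
        fix x :: real
        let ?B = "fps_binomial (complex_of_real x)"
        have z: "norm z < 1" "ereal (norm z) < fps_conv_radius ?A" "ereal (norm z) < fps_conv_radius ?B"
          using elim by (auto simp: fps_conv_radius_binomial)
        then have "1 + z \<noteq> 0"
          by (metis add_eq_0_iff norm_minus_cancel norm_one less_irrefl)
        then have "?f x z = eval_fps ?A z * eval_fps ?B z"
          using elim z by (simp add: eval_fps_binomial powr_def field_simps)
        also have "\<dots> = eval_fps (?A * ?B) z"
          using z by (simp add: eval_fps_mult)
        also have "ereal (norm z) < fps_conv_radius (?A * ?B)"
          using z fps_conv_radius_mult[of ?A ?B] by (auto simp: min_def split: if_splits)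
        then have "(\<lambda>n. fps_nth (?A * ?B) n * z ^ n) sums eval_fps (?A * ?B) z"
          by (rule sums_eval_fps)
        also have "(\<lambda>n. fps_nth (?A * ?B) n * z ^ n) = (\<lambda>n. z ^ n / fact n * poly (?C n) (of_real x))"
          by (simp add: fun_eq_iff fps_mult_nth atLeast0AtMost poly_sum poly_binom_poly)
        finally show "(\<lambda>n. z ^ n / fact n * poly (?C n) (of_real x)) sums ?f x z" .
      qed
    qed
  qed
  \<comment> \<open>Uniqueness: convergence at the single point \<open>r / 2\<close> gives a
    positive radius, so the generating function fixes the values at each real \<open>x\<close>, and
    infinitely many values fix a polynomial.\<close>
  have expansion: "?f x has_fps_expansion Abs_fps (\<lambda>n. poly (D n) (of_real x) / fact n)"
    if D: "\<forall>\<^sub>F z in nhds 0. \<forall>x::real. (\<lambda>n. z ^ n / fact n * poly (D n) (of_real x)) sums ?f x z" for D x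
  proof -
    let ?G = "Abs_fps (\<lambda>n. poly (D n) (of_real x) / fact n) :: complex fps"
    have *: "\<forall>\<^sub>F z in nhds 0. (\<lambda>n. fps_nth ?G n * z ^ n) sums ?f x z"
      using D by eventually_elim (simp add: mult_ac)
    then obtain r where r: "r > 0" "\<And>z. norm z < r \<Longrightarrow> (\<lambda>n. fps_nth ?G n * z ^ n) sums ?f x z"
      unfolding eventually_nhds_metric by auto
    have "summable (\<lambda>n. fps_nth ?G n * of_real (r / 2) ^ n)"
      using r(2)[of "of_real (r / 2)"] r(1) by (auto simp: sums_iff)
    from conv_radius_geI[OF this] have "ereal (r / 2) \<le> fps_conv_radius ?G"
      using r(1) by (simp add: fps_conv_radius_def)
    moreover have "0 < ereal (r / 2)" using r(1) by simp
    ultimately have "fps_conv_radius ?G > 0" by (rule less_le_trans[rotated])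
    moreover have "\<forall>\<^sub>F z in nhds 0. eval_fps ?G z = ?f x z"
      using * by eventually_elim (simp add: eval_fps_def sums_iff)
    ultimately show ?thesis by (simp add: has_fps_expansion_def)
  qed
  show ?thesis
    unfolding gen_appell_def
  proof (rule the_equality)
    show "\<forall>\<^sub>F z in nhds 0. \<forall>x::real. (\<lambda>n. z ^ n / fact n * poly (?C n) (of_real x)) sums ?f x z"
      by (rule C)
  next
    fix D
    assume D: "\<forall>\<^sub>F z in nhds 0. \<forall>x::real. (\<lambda>n. z ^ n / fact n * poly (D n) (of_real x)) sums ?f x z"
    have "poly (D n) (of_real x) = poly (?C n) (of_real x)" for n and x :: real
    proof -
      have "poly (D n) (of_real x) / fact n = poly (?C n) (of_real x) / (fact n :: complex)"
        using fps_expansion_unique_complex[OF expansion[OF D] expansion[OF C], of x]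
        by (simp only: fps_eq_iff fps_nth_Abs_fps)
      then show ?thesis by (metis divide_cancel_right fact_nonzero)
    qed
    then have "range complex_of_real \<subseteq> {z. poly (D n - ?C n) z = 0}" for n
      by auto
    moreover have "infinite (range complex_of_real)"
      by (simp add: infinite_UNIV_char_0 inj_of_real finite_image_iff)
    ultimately have "infinite {z. poly (D n - ?C n) z = 0}" for n
      using finite_subset by blast
    then have "D n - ?C n = 0" for n
      using poly_roots_finite by blast
    then show "D = ?C" by (simp add: fun_eq_iff)
  qed
qed

section \<open>Dual functionals and biorthogonality\<close>

text \<open>Continuity is automatic: with degrees bounded by \<open>d\<close>, a linear functional
  is a fixed finite combination of coefficients.\<close>

lemma linear_functional_in_poly_dual:
  assumes add: "\<And>p q. \<Psi> (p + q) = \<Psi> p + \<Psi> q" and smult: "\<And>c p. \<Psi> (smult c p) = c * \<Psi> p"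
  shows "\<Psi> \<in> poly_dual"
proof -
  have "vector_space (smult :: complex \<Rightarrow> complex poly \<Rightarrow> complex poly)"
    by unfold_locales (simp_all add: smult_add_right smult_add_left)
  moreover have "vector_space ((*) :: complex \<Rightarrow> complex \<Rightarrow> complex)"
    by unfold_locales (simp_all add: algebra_simps)
  ultimately have lin: "Vector_Spaces.linear smult (*) \<Psi>"
    using assms by (simp add: Vector_Spaces.linear_iff)
  have "\<Psi> 0 = 0" using smult[of 0 0] by simp
  then have sum: "\<Psi> (sum f A) = (\<Sum>x\<in>A. \<Psi> (f x))" for f :: "nat \<Rightarrow> complex poly" and A
    by (induction A rule: infinite_finite_induct) (simp_all add: add)
  have expand: "\<Psi> p = (\<Sum>i\<le>d. coeff p i * \<Psi> (monom 1 i))" if "degree p \<le> d" for p d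
  proof -
    have "p = (\<Sum>i\<le>d. smult (coeff p i) (monom 1 i))"
      using poly_as_sum_of_monoms'[OF that] by (simp add: smult_monom)
    then show ?thesis by (metis (no_types, lifting) sum smult sum.cong)
  qed
  have "(\<lambda>n. \<Psi> (p n)) \<longlonglongrightarrow> \<Psi> q" if "poly_converges p q" for p q
  proof -
    from that obtain d where d: "\<And>n. degree (p n) \<le> d"
      and lim: "\<And>i. (\<lambda>n. coeff (p n) i) \<longlonglongrightarrow> coeff q i"
      by (auto simp: poly_converges_def)
    \<comment> \<open>The limit obeys the same degree bound, because its coefficients above
      \<open>d\<close> are limits of zero sequences.\<close>
    have "degree q \<le> d"
    proof (rule degree_le, intro allI impI)
      fix i assume "i > d"
      then have "(\<lambda>n. coeff (p n) i) = (\<lambda>n. 0)"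
        using d by (auto simp: fun_eq_iff intro: coeff_eq_0 le_less_trans)
      with lim[of i] show "coeff q i = 0"
        using LIMSEQ_unique tendsto_const by metis
    qed
    then show ?thesis
      unfolding expand[OF d] expand[OF \<open>degree q \<le> d\<close>] by (intro tendsto_intros lim)
  qed
  with lin show ?thesis by (simp add: poly_dual_def)
qed

text \<open>The adjoint equation prescribes the value at every polynomial, so only membership in the
  dual has to be supplied.\<close>

lemma dual_adjoint_eq:
  assumes "(\<lambda>p. \<Phi> (T p)) \<in> poly_dual"
  shows "dual_adjoint T \<Phi> = (\<lambda>p. \<Phi> (T p))"
  unfolding dual_adjoint_def dual_pairing_def
  by (rule the_equality) (use assms in \<open>auto simp: fun_eq_iff\<close>)

theorem theorem4p2:
  fixes l \<beta> :: real
  assumes "l > 0" and "0 < \<beta>" and "\<beta> \<le> 1"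
  shows "\<forall>n m. dual_pairing (gen_appell l \<beta> n) (dual_appell l \<beta> m)
           = (if n = m then fact n else 0)"
proof (intro allI)
  fix n m
  let ?M = "fractional_poisson l \<beta>" and ?F = "scaled_mittag_leffler_fps l \<beta>"
  define L where "L = L2_functional ?M (\<lambda>x. 1)"
  have L_eq: "L p = (\<integral>x. poly p (of_real x) \<partial>?M)" for p
    by (simp add: L_def L2_functional_def)
  note int = integrable_poly_fractional_poisson[OF assms(2,3,1)]
  have L_add: "L (p + q) = L p + L q" for p q
    by (simp add: L_eq int)
  have L_smult: "L (smult c p) = c * L p" for c p
    by (simp add: L_eq)
  have L_0: "L 0 = 0" by (simp add: L_eq)
  have L_sum: "L (sum f A) = (\<Sum>x\<in>A. L (f x))" for f :: "nat \<Rightarrow> complex poly" and A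
    by (induction A rule: infinite_finite_induct) (simp_all add: L_add L_0)
  have L_binom: "L (binom_poly r) = fps_nth ?F r" for r
    by (simp add: L_eq factorial_moment_integral(2)[OF assms(2,3,1)] scaled_mittag_leffler_fps_def)
  have "dual_appell l \<beta> m = (\<lambda>p. L (g_nabla_pow m p))"
    unfolding dual_appell_def L_def[symmetric]
    by (intro dual_adjoint_eq linear_functional_in_poly_dual)
      (simp_all add: g_nabla_pow_add g_nabla_pow_smult L_add L_smult)
  then have "dual_pairing (gen_appell l \<beta> n) (dual_appell l \<beta> m) =
      fact n * (\<Sum>j\<le>n. fps_nth (inverse ?F) j * (if m \<le> n - j then fps_nth ?F (n - j - m) else 0))"
    by (simp add: dual_pairing_def gen_appell_eq assms g_nabla_pow_smult g_nabla_pow_sum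
        g_nabla_pow_binom_poly L_smult L_sum L_0 L_binom if_distrib[of L] cong: if_cong)
  also have "\<dots> = (if n = m then fact n else 0)"
  proof (cases "m \<le> n")
    case True
    \<comment> \<open>Terms with \<open>j > n - m\<close> vanish by the guard; the rest is a Cauchy
      product coefficient.\<close>
    have "(\<Sum>j\<le>n. fps_nth (inverse ?F) j * (if m \<le> n - j then fps_nth ?F (n - j - m) else 0)) =
        (\<Sum>j\<le>n - m. fps_nth (inverse ?F) j * fps_nth ?F (n - m - j))"
      using True by (intro sum.mono_neutral_cong_right) (auto simp: add.commute)
    also have "\<dots> = fps_nth (inverse ?F * ?F) (n - m)"
      by (simp add: fps_mult_nth atLeast0AtMost)
    also have "inverse ?F * ?F = 1"
      by (rule inverse_mult_eq_1) (simp add: scaled_mittag_leffler_fps_nth_0)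
    finally show ?thesis using True by (simp add: fps_one_nth)
  next
    case False
    then show ?thesis by (auto intro!: sum.neutral)
  qed
  finally show "dual_pairing (gen_appell l \<beta> n) (dual_appell l \<beta> m) = (if n = m then fact n else 0)" .
qed

end
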